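(* Consider the source–channel–destination system described in the context, operated under a stationary randomized policy with action probabilities $p_0,p_1,p_2,p_3\ge 0$, $p_0+p_1+p_2+p_3=1$. The (steady-state) expected distortion and expected age of information of state $1$ at the destination under this policy are given by $$\mathbb{E}\left[\Delta(X_t,\hat X_t)\right] = \frac{2(1-p_s)\,p_{1,0}^X\, p_{0,1}^X}{\left(p_{0,1}^X+p_{1,0}^X\right)\left(1+(1-p_s)\left(p_{1,0}^X-p_{0,0}^X\right)\right)}$$ and $$\mathbb{E}\left[a_1^d(t)\right] = \frac{1}{p_s}\left(1-p_s\,\mathbb{P}\{\hat X=0\}\right),$$ respectively, where $$p_s = p_1\, p_1^r\, \mathbb{P}\{h=1\} + p_3\left(\mathbb{P}\{h=1\} + p_0^p\, \mathbb{P}\{h=0\}\right)$$ is the probability that the destination receives the information successfully in a slot, and $\mathbb{P}\{\hat X=0\}$ is the steady-state probability of the estimate of the stochastic process being in state $0$.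
   Context: Time is slotted, $t\in\{1,2,\dots\}$. Source. The monitored process $X_t\in\{0,1\}$ evolves as a two-state Markov chain; $p_{i,j}^X$ denotes the probability of a transition from state $i$ to state $j$. Channel. The channel state $h_t\in\{0,1\}$ is bad ($0$) or good ($1$) and evolves as a separate two-state Markov chain; $p_{i,j}^h$ denotes the probability of a transition from channel state $i$ to channel state $j$. Its steady-state probabilities are $\mathbb{P}\{h=0\}=p_{1,0}^h/(p_{0,1}^h+p_{1,0}^h)$ and $\mathbb{P}\{h=1\}=p_{0,1}^h/(p_{0,1}^h+p_{1,0}^h)$. A transmission of raw information succeeds with probability $p_1^r$, $0<p_1^r\le 1$, if the channel is good and with probability $0$ if it is bad. A transmission of processed information succeeds with probability $1$ if the channel is good and with probability $p_0^p$, $0<p_0^p<1$, if it is bad. The destination sends an acknowledgment (ACK) to the source after a successful reception. Stationary randomized policy (SRP). In each slot the source chooses one of four actions, with probabilities that do not depend on the slot index or on the ACKs: with probability $p_0$ it does not sample the process; with probability $p_1$ it samples and transmits the raw information; with probability $p_2$ it samples and processes but does not transmit; with probability $p_3$ it samples, processes and transmits the processed information. Estimate. The destination's estimate of $X_t$ is $\hat X_t = X_\tau$, where $\tau$ is the latest time instant at which a sample from the source was received at the destination. Distortion. $\Delta(X_t,\hat X_t)=0$ if $X_t=\hat X_t$, and $\Delta(X_t,\hat X_t)=1$ if $X_t\ne\hat X_t$. Age of information (AoI) of state $1$ at the destination, $a_1^d(t)$. If in slot $t$ information (raw or processed) is transmitted and successfully received (with the success probabilities above, given the action and the channel state $h_t$),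 then $a_1^d(t+1)=0$ when $\hat X_t=0$ and $a_1^d(t+1)=1$ when $\hat X_t=1$. Otherwise $a_1^d(t+1)=a_1^d(t)+1$.
   Formalization: The channel states of different slots are taken independent, each with the steady-state law of the channel chain (with channel memory the age formula is false); p_s > 0 and p_{0,1}+p_{1,0} > 0 for source and channel are assumed so that the formulas are defined. *)

theory Defs
  imports "HOL-Probability.Probability"
begin

text \<open>
  Both the source and the channel take values in the states 0 and 1, encoded as natural numbers;
  a transition matrix is a function \<open>p\<close> with \<open>p i j\<close> the probability of moving from \<open>i\<close> to \<open>j\<close>.
  Slots are the natural numbers \<open>t \<ge> 1\<close>; values of the processes at \<open>t = 0\<close> are never used.
\<close>

definition transition_matrix :: "(nat \<Rightarrow> nat \<Rightarrow> real) \<Rightarrow> bool" where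
  "transition_matrix p \<longleftrightarrow>
     (\<forall>i\<in>{0, 1}. 0 \<le> p i 0 \<and> 0 \<le> p i 1 \<and> p i 0 + p i 1 = 1)"

definition steady_prob :: "(nat \<Rightarrow> nat \<Rightarrow> real) \<Rightarrow> nat \<Rightarrow> real" where
  "steady_prob p i = (if i = 0 then p 1 0 else p 0 1) / (p 0 1 + p 1 0)"

text \<open>
  The Markov property is stated in product form on finite paths, so that nothing is conditioned on
  a null event. The law of the first state is arbitrary.
\<close>

definition two_state_markov_chain ::
    "'w measure \<Rightarrow> (nat \<Rightarrow> nat \<Rightarrow> real) \<Rightarrow> (nat \<Rightarrow> 'w \<Rightarrow> nat) \<Rightarrow> bool" where
  "two_state_markov_chain M p Y \<longleftrightarrow>
     transition_matrix p \<and>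
     (\<forall>t\<ge>1. Y t \<in> measurable M (count_space UNIV)) \<and>
     (\<forall>t\<ge>1. \<forall>\<omega>\<in>space M. Y t \<omega> \<in> {0, 1}) \<and>
     (\<forall>n\<ge>1. \<forall>y. (\<forall>t. y t \<in> {0, 1}) \<longrightarrow>
        measure M {\<omega> \<in> space M. \<forall>t\<in>{1..n + 1}. Y t \<omega> = y t} =
        measure M {\<omega> \<in> space M. \<forall>t\<in>{1..n}. Y t \<omega> = y t} * p (y n) (y (n + 1)))"

datatype action = No_Sample | Send_Raw | Process_Only | Send_Processed

fun policy_prob :: "real \<Rightarrow> real \<Rightarrow> real \<Rightarrow> real \<Rightarrow> action \<Rightarrow> real" where
  "policy_prob p0 p1 p2 p3 No_Sample = p0"
| "policy_prob p0 p1 p2 p3 Send_Raw = p1"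
| "policy_prob p0 p1 p2 p3 Process_Only = p2"
| "policy_prob p0 p1 p2 p3 Send_Processed = p3"

fun reception_prob :: "real \<Rightarrow> real \<Rightarrow> action \<Rightarrow> nat \<Rightarrow> real" where
  "reception_prob p1r p0p No_Sample c = 0"
| "reception_prob p1r p0p Send_Raw c = (if c = 1 then p1r else 0)"
| "reception_prob p1r p0p Process_Only c = 0"
| "reception_prob p1r p0p Send_Processed c = (if c = 1 then 1 else p0p)"

text \<open>
  \<open>X\<close> is the source, \<open>h\<close> the channel state, \<open>A\<close> the action taken and \<open>D t\<close> the event that the
  transmission of slot \<open>t\<close> is received.

  The channel is in steady state in the following sense: in each slot its state follows the
  stationary law of the transition matrix \<open>ph\<close>, and the slots are independent of one another.
  Independence is essential. For a channel with memory (a Markov path with \<open>ph 0 1 + ph 1 0 \<noteq> 1\<close>)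
  the receptions of different slots are correlated, so that the age and the distortion depend on
  \<open>ph\<close> not only through the reception probability of a single slot.
\<close>

locale srp_system = prob_space M for M :: "'w measure" +
  fixes X h :: "nat \<Rightarrow> 'w \<Rightarrow> nat"
    and A :: "nat \<Rightarrow> 'w \<Rightarrow> action"
    and D :: "nat \<Rightarrow> 'w \<Rightarrow> bool"
    and pX ph :: "nat \<Rightarrow> nat \<Rightarrow> real"
    and p1r p0p p0 p1 p2 p3 :: real
  assumes source: "two_state_markov_chain M pX X"
    and source_steady: "0 < pX 0 1 + pX 1 0"
    and channel: "transition_matrix ph"
    and channel_steady: "0 < ph 0 1 + ph 1 0"
    and raw_success: "0 < p1r" "p1r \<le> 1"
    and processed_success: "0 < p0p" "p0p < 1"
    and policy: "0 \<le> p0" "0 \<le> p1" "0 \<le> p2" "0 \<le> p3" "p0 + p1 + p2 + p3 = 1"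
    and channel_states: "\<And>t \<omega>. 1 \<le> t \<Longrightarrow> \<omega> \<in> space M \<Longrightarrow> h t \<omega> \<in> {0, 1}"
    and channel_action: "\<And>t c a. 1 \<le> t \<Longrightarrow> c \<in> {0, 1} \<Longrightarrow>
          measure M {\<omega> \<in> space M. h t \<omega> = c \<and> A t \<omega> = a} =
          steady_prob ph c * policy_prob p0 p1 p2 p3 a"
    and reception: "\<And>t c a. 1 \<le> t \<Longrightarrow> c \<in> {0, 1} \<Longrightarrow>
          measure M {\<omega> \<in> space M. h t \<omega> = c \<and> A t \<omega> = a \<and> D t \<omega>} =
          measure M {\<omega> \<in> space M. h t \<omega> = c \<and> A t \<omega> = a} * reception_prob p1r p0p a c"
    and slots_indep:
          "indep_vars (\<lambda>_. count_space UNIV) (\<lambda>t \<omega>. (h t \<omega>, A t \<omega>, D t \<omega>)) {1..}"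
    and source_indep: "\<And>n x c a d.
          measure M {\<omega> \<in> space M. \<forall>t\<in>{1..n}. X t \<omega> = x t \<and> h t \<omega> = c t \<and> A t \<omega> = a t \<and> D t \<omega> = d t} =
          measure M {\<omega> \<in> space M. \<forall>t\<in>{1..n}. X t \<omega> = x t} *
          measure M {\<omega> \<in> space M. \<forall>t\<in>{1..n}. h t \<omega> = c t \<and> A t \<omega> = a t \<and> D t \<omega> = d t}"

definition success_prob ::
    "(nat \<Rightarrow> nat \<Rightarrow> real) \<Rightarrow> real \<Rightarrow> real \<Rightarrow> real \<Rightarrow> real \<Rightarrow> real" where
  "success_prob ph p1r p0p p1 p3 =
     p1 * p1r * steady_prob ph 1 + p3 * (steady_prob ph 1 + p0p * steady_prob ph 0)"

text \<open>
  The value \<open>x0\<close> is the estimate in use before the first reception. A sample received in slot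
  \<open>t\<close> is already used for the estimate of slot \<open>t\<close>.
\<close>

definition estimate ::
    "nat \<Rightarrow> (nat \<Rightarrow> 'w \<Rightarrow> nat) \<Rightarrow> (nat \<Rightarrow> 'w \<Rightarrow> bool) \<Rightarrow> nat \<Rightarrow> 'w \<Rightarrow> nat" where
  "estimate x0 X D t \<omega> =
     (if \<exists>s\<in>{1..t}. D s \<omega> then X (Max {s \<in> {1..t}. D s \<omega>}) \<omega> else x0)"

definition distortion :: "nat \<Rightarrow> nat \<Rightarrow> real" where
  "distortion x y = (if x = y then 0 else 1)"

text \<open>The value \<open>a0\<close> is the age in slot 1.\<close>

fun aoi1 ::
    "nat \<Rightarrow> nat \<Rightarrow> (nat \<Rightarrow> 'w \<Rightarrow> nat) \<Rightarrow> (nat \<Rightarrow> 'w \<Rightarrow> bool) \<Rightarrow> nat \<Rightarrow> 'w \<Rightarrow> nat" where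
  "aoi1 a0 x0 X D 0 \<omega> = a0"
| "aoi1 a0 x0 X D (Suc t) \<omega> =
     (if t = 0 then a0
      else if D t \<omega> then (if estimate x0 X D t \<omega> = 0 then 0 else 1)
      else aoi1 a0 x0 X D t \<omega> + 1)"

end

theory Submission
  imports Defs
begin

text \<open>
  Given the history of source states and receptions up to slot \<open>n\<close>, the next source state follows row
  \<open>X n\<close> of \<open>pX\<close> and the next reception is an independent Bernoulli variable with parameter \<open>p_s\<close>
  (\<open>expectation_Suc\<close>). Put \<open>q = 1 - p_s\<close>, \<open>a = pX 0 1\<close>, \<open>b = pX 1 0\<close>, \<open>c = 1 - a - b\<close>. Then
  \<open>P(X = 0)\<close>, \<open>P(estimate = 0)\<close> and the expected age obey scalar affine recursions. The mismatch
  probability does not, but the mismatch weighted by the probability \<open>b\<close> or \<open>a\<close> of leaving the current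
  source state does, with factor \<open>q * c\<close>: this weighting is a left eigenvector of the recursion for the
  pair \<open>(P(X = 1, estimate = 0), P(X = 0, estimate = 1))\<close>. The distortion differs from a multiple of
  it by a multiple of \<open>(a - b) * (P(estimate = 0) - P(X = 0))\<close>, which vanishes in the limit: if the
  source is periodic, then \<open>a = b\<close>, and otherwise both probabilities have the same limit.
\<close>

subsection \<open>Preliminaries\<close>

text \<open>The distance \<open>e\<close> to the fixed point \<open>B / (1 - c)\<close> contracts up
  to a small error, because the forcing term \<open>b\<close> is eventually close to
  \<open>B\<close>. Convergent rather than constant forcing is allowed, since below one probability
  drives the recursion of another.\<close>

lemma affine_recursion_tendsto:
  fixes r b :: "nat \<Rightarrow> real"
  assumes c: "\<bar>c\<bar> < 1"
    and rec: "\<And>n. N \<le> n \<Longrightarrow> r (Suc n) = c * r n + b n"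
    and b: "b \<longlonglongrightarrow> B"
  shows "r \<longlonglongrightarrow> B / (1 - c)"
proof (rule LIMSEQ_I)
  fix \<epsilon> :: real assume "0 < \<epsilon>"
  define e where "e n = r n - B / (1 - c)" for n
  \<comment> \<open>Chosen so that
    \<open>\<bar>c\<bar> * (\<epsilon> / 2) + \<delta> = \<epsilon> / 2\<close>: the bound
    \<open>\<epsilon> / 2\<close> then reproduces itself in the induction for
    \<open>e_bound\<close>.\<close>
  define \<delta> where "\<delta> = \<epsilon> / 2 * (1 - \<bar>c\<bar>)"
  have "0 < \<delta>" using \<open>0 < \<epsilon>\<close> c by (simp add: \<delta>_def)
  then obtain K where K: "\<And>n. K \<le> n \<Longrightarrow> \<bar>b n - B\<bar> < \<delta>"
    using LIMSEQ_D[OF b] by (metis real_norm_def)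
  define L where "L = max K N"
  have "B / (1 - c) * (1 - c) = B" using c by simp
  then have B: "B / (1 - c) - c * (B / (1 - c)) = B" by (simp only: left_diff_distrib mult_1 mult.commute[of _ "1 - c"])
  have e_step: "\<bar>e (Suc n)\<bar> \<le> \<bar>c\<bar> * \<bar>e n\<bar> + \<delta>" if "L \<le> n" for n
  proof -
    have "e (Suc n) = c * e n + (b n - B)"
      using rec[of n] that B unfolding e_def right_diff_distrib by (simp add: L_def)
    then have "\<bar>e (Suc n)\<bar> \<le> \<bar>c * e n\<bar> + \<bar>b n - B\<bar>" by linarith
    also have "\<dots> \<le> \<bar>c\<bar> * \<bar>e n\<bar> + \<delta>"
      using K[of n] that by (simp add: abs_mult L_def)
    finally show ?thesis .
  qed
  have e_bound: "\<bar>e (L + k)\<bar> \<le> \<bar>c\<bar> ^ k * \<bar>e L\<bar> + \<epsilon> / 2" for k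
  proof (induction k)
    case 0
    then show ?case using \<open>0 < \<epsilon>\<close> by simp
  next
    case (Suc k)
    have "\<bar>e (L + Suc k)\<bar> \<le> \<bar>c\<bar> * \<bar>e (L + k)\<bar> + \<delta>" using e_step[of "L + k"] by simp
    also have "\<dots> \<le> \<bar>c\<bar> * (\<bar>c\<bar> ^ k * \<bar>e L\<bar> + \<epsilon> / 2) + \<delta>"
      using Suc by (simp add: mult_left_mono)
    also have "\<dots> = \<bar>c\<bar> ^ Suc k * \<bar>e L\<bar> + \<epsilon> / 2"
      by (simp add: \<delta>_def field_simps)
    finally show ?case .
  qed
  have "(\<lambda>k. \<bar>c\<bar> ^ k * \<bar>e L\<bar>) \<longlonglongrightarrow> 0"
    using c by (intro tendsto_mult_left_zero LIMSEQ_power_zero) simp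
  then obtain J where J: "\<And>k. J \<le> k \<Longrightarrow> \<bar>\<bar>c\<bar> ^ k * \<bar>e L\<bar>\<bar> < \<epsilon> / 2"
    using LIMSEQ_D[of _ 0 "\<epsilon> / 2"] \<open>0 < \<epsilon>\<close> by (metis diff_zero half_gt_zero real_norm_def)
  have "norm (r n - B / (1 - c)) < \<epsilon>" if "L + J \<le> n" for n
  proof -
    have "\<bar>e n\<bar> \<le> \<bar>c\<bar> ^ (n - L) * \<bar>e L\<bar> + \<epsilon> / 2" using e_bound[of "n - L"] that by simp
    also have "\<bar>c\<bar> ^ (n - L) * \<bar>e L\<bar> < \<epsilon> / 2" using J[of "n - L"] that by linarith
    finally show ?thesis by (simp add: e_def)
  qed
  then show "\<exists>n0. \<forall>n\<ge>n0. norm (r n - B / (1 - c)) < \<epsilon>" by blast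
qed

text \<open>Total probability over a finite-valued \<open>g\<close>. Measurability is asked only of
  the fibres over \<open>F\<close>, so \<open>g\<close> may take whole paths as values without a
  sigma-algebra on paths.\<close>

lemma (in finite_measure) measure_eq_sum_fibres:
  assumes "finite F" "S \<in> sets M"
    and "\<And>y. y \<in> F \<Longrightarrow> {\<omega> \<in> space M. g \<omega> = y} \<in> sets M"
    and "\<And>\<omega>. \<omega> \<in> S \<Longrightarrow> g \<omega> \<in> F"
  shows "measure M S = (\<Sum>y\<in>F. measure M {\<omega> \<in> S. g \<omega> = y})"
proof -
  have eq: "{\<omega> \<in> S. g \<omega> = y} = S \<inter> {\<omega> \<in> space M. g \<omega> = y}" for y
    using sets.sets_into_space[OF assms(2)] by auto
  have "measure M (\<Union>y\<in>F. {\<omega> \<in> S. g \<omega> = y}) = (\<Sum>y\<in>F. measure M {\<omega> \<in> S. g \<omega> = y})"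
    using assms by (intro finite_measure_finite_Union) (auto simp: eq disjoint_family_on_def)
  moreover have "(\<Union>y\<in>F. {\<omega> \<in> S. g \<omega> = y}) = S" using assms(4) by auto
  ultimately show ?thesis by simp
qed

text \<open>Finite paths are encoded as elements of a \<open>PiE\<close>, so that there are finitely
  many of them; extensionality turns equality of such functions into agreement on
  \<open>S\<close>.\<close>

lemma restrict_pair_eq_iff:
  assumes "y \<in> extensional S"
  shows "restrict (\<lambda>t. (f t, g t)) S = y \<longleftrightarrow> (\<forall>t\<in>S. f t = fst (y t) \<and> g t = snd (y t))"
  using assms by (auto intro!: extensionalityI[where A=S] simp: prod_eq_iff)

lemma UNIV_action: "UNIV = {No_Sample, Send_Raw, Process_Only, Send_Processed}"
  using action.exhaust by auto

lemma finite_action: "finite (UNIV :: action set)"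
  by (simp add: UNIV_action)

subsection \<open>Histories of the source and of the receptions\<close>

text \<open>A reception in slot \<open>Suc t\<close> makes that slot the maximum; otherwise the set
  of reception slots does not change. Later arguments use this one-step update instead of
  \<open>Max\<close>.\<close>

lemma estimate_Suc:
  "estimate x0 X D (Suc t) \<omega> = (if D (Suc t) \<omega> then X (Suc t) \<omega> else estimate x0 X D t \<omega>)"
proof (cases "D (Suc t) \<omega>")
  case True
  then have "Max {s \<in> {1..Suc t}. D s \<omega>} = Suc t"
    by (intro Max_eqI) auto
  then show ?thesis using True by (auto simp: estimate_def)
next
  case False
  then have "{s \<in> {1..Suc t}. D s \<omega>} = {s \<in> {1..t}. D s \<omega>}"
    and "(\<exists>s\<in>{1..Suc t}. D s \<omega>) \<longleftrightarrow> (\<exists>s\<in>{1..t}. D s \<omega>)"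
    by (auto simp: le_Suc_eq)
  then show ?thesis using False by (simp add: estimate_def)
qed

lemma estimate_cong:
  assumes "\<And>s. s \<in> {1..t} \<Longrightarrow> X s \<omega> = X s \<omega>' \<and> D s \<omega> = D s \<omega>'"
  shows "estimate x0 X D t \<omega> = estimate x0 X D t \<omega>'"
  using assms by (induction t) (simp_all add: estimate_Suc, simp add: estimate_def)

text \<open>The range is half-open because the age in a slot is settled by strictly earlier slots;
  hence the age of slot \<open>Suc n\<close> belongs to the history up to \<open>n\<close>.\<close>

lemma aoi1_cong:
  assumes "\<And>s. s \<in> {1..<t} \<Longrightarrow> X s \<omega> = X s \<omega>' \<and> D s \<omega> = D s \<omega>'"
  shows "aoi1 a0 x0 X D t \<omega> = aoi1 a0 x0 X D t \<omega>'"
  using assms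
proof (induction t)
  case (Suc t)
  then show ?case
    using estimate_cong[of t X \<omega> \<omega>' D x0] by (cases "t = 0") auto
qed simp

context srp_system
begin

section \<open>Measurable events and the reception probability of a slot\<close>

lemma source_transition: "pX 0 0 = 1 - pX 0 1" "pX 1 1 = 1 - pX 1 0"
  "0 \<le> pX 0 1" "pX 0 1 \<le> 1" "0 \<le> pX 1 0" "pX 1 0 \<le> 1"
proof -
  have "transition_matrix pX" using source by (simp add: two_state_markov_chain_def)
  then show "pX 0 0 = 1 - pX 0 1" "pX 1 1 = 1 - pX 1 0"
    "0 \<le> pX 0 1" "pX 0 1 \<le> 1" "0 \<le> pX 1 0" "pX 1 0 \<le> 1"
    by (auto simp: transition_matrix_def)
qed

lemma source_states: "1 \<le> t \<Longrightarrow> \<omega> \<in> space M \<Longrightarrow> X t \<omega> = 0 \<or> X t \<omega> = 1"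
  using source by (auto simp: two_state_markov_chain_def)

lemma source_measurable: "1 \<le> t \<Longrightarrow> X t \<in> measurable M (count_space UNIV)"
  using source by (auto simp: two_state_markov_chain_def)

lemma slot_measurable:
  "1 \<le> t \<Longrightarrow> (\<lambda>\<omega>. (h t \<omega>, A t \<omega>, D t \<omega>)) \<in> measurable M (count_space UNIV)"
  using slots_indep by (auto simp: indep_vars_def)

lemma source_event: "1 \<le> t \<Longrightarrow> {\<omega> \<in> space M. P (X t \<omega>)} \<in> events"
  using measurable_sets[OF source_measurable, of t "{x. P x}"]
  by (auto simp: vimage_def Int_def conj_commute)

lemma slot_event: "1 \<le> t \<Longrightarrow> {\<omega> \<in> space M. P (h t \<omega>) (A t \<omega>) (D t \<omega>)} \<in> events"
  using measurable_sets[OF slot_measurable, of t "{(c, a, d). P c a d}"]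
  by (auto simp: vimage_def Int_def conj_commute)

lemma reception_event: "1 \<le> t \<Longrightarrow> {\<omega> \<in> space M. D t \<omega>} \<in> events"
  using slot_event[of t "\<lambda>_ _ d. d"] by simp

lemma path_event:
  "{\<omega> \<in> space M. \<forall>t\<in>{1..n}. Q t (X t \<omega>) \<and> R t (h t \<omega>) (A t \<omega>) (D t \<omega>)} \<in> events"
  by (rule sets.sets_Collect_finite_All) (auto intro!: sets.sets_Collect_conj source_event slot_event)

text \<open>Total probability over the channel state and the action: only the two transmitting
  actions can contribute, and their terms add up to \<open>success_prob\<close>.\<close>

lemma prob_reception:
  assumes "1 \<le> t"
  shows "prob {\<omega> \<in> space M. D t \<omega>} = success_prob ph p1r p0p p1 p3"
proof -
  have "prob {\<omega> \<in> space M. D t \<omega>} =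
      (\<Sum>y\<in>{0, 1} \<times> UNIV. prob {\<omega> \<in> {\<omega> \<in> space M. D t \<omega>}. (h t \<omega>, A t \<omega>) = y})"
    using channel_states[OF assms] slot_event[OF assms, of "\<lambda>c a _. (c, a) = y" for y]
    by (intro measure_eq_sum_fibres reception_event[OF assms] finite_cartesian_product finite_action) auto
  also have "\<dots> = (\<Sum>(c, a)\<in>{0, 1} \<times> UNIV.
      steady_prob ph c * policy_prob p0 p1 p2 p3 a * reception_prob p1r p0p a c)"
  proof (intro sum.cong refl, clarify)
    fix c :: nat and a
    assume "c \<in> {0, 1}"
    then have "prob {\<omega> \<in> space M. h t \<omega> = c \<and> A t \<omega> = a \<and> D t \<omega>} =
        steady_prob ph c * policy_prob p0 p1 p2 p3 a * reception_prob p1r p0p a c"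
      using reception[OF assms] channel_action[OF assms] by simp
    moreover have "{\<omega> \<in> {\<omega> \<in> space M. D t \<omega>}. (h t \<omega>, A t \<omega>) = (c, a)} =
        {\<omega> \<in> space M. h t \<omega> = c \<and> A t \<omega> = a \<and> D t \<omega>}" by auto
    ultimately show "prob {\<omega> \<in> {\<omega> \<in> space M. D t \<omega>}. (h t \<omega>, A t \<omega>) = (c, a)} =
        steady_prob ph c * policy_prob p0 p1 p2 p3 a * reception_prob p1r p0p a c" by simp
  qed
  also have "\<dots> = success_prob ph p1r p0p p1 p3"
    by (simp add: sum.cartesian_product[symmetric] UNIV_action success_prob_def algebra_simps)
  finally show ?thesis .
qed

lemma prob_reception_eq:
  assumes "1 \<le> t"
  shows "prob {\<omega> \<in> space M. D t \<omega> = d} =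
    (if d then success_prob ph p1r p0p p1 p3 else 1 - success_prob ph p1r p0p p1 p3)"
  using prob_neg[OF reception_event[OF assms]] prob_reception[OF assms]
  by (cases d) simp_all

section \<open>Product form of the joint law of source and receptions\<close>

lemma reception_path_Suc:
  "prob {\<omega> \<in> space M. \<forall>t\<in>{1..Suc n}. D t \<omega> = d t} =
   prob {\<omega> \<in> space M. \<forall>t\<in>{1..n}. D t \<omega> = d t} * prob {\<omega> \<in> space M. D (Suc n) \<omega> = d (Suc n)}"
proof -
  have "indep_vars (\<lambda>_. count_space UNIV) (\<lambda>t \<omega>. snd (snd (h t \<omega>, A t \<omega>, D t \<omega>))) {1..}"
    by (rule indep_vars_compose2[OF slots_indep]) simp
  then have indep: "indep_vars (\<lambda>_. count_space UNIV) D {1..}" by simp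
  have path: "prob {\<omega> \<in> space M. \<forall>t\<in>{1..m}. D t \<omega> = d t} =
      (\<Prod>t\<in>{1..m}. prob {\<omega> \<in> space M. D t \<omega> = d t})" for m
  proof (cases "m = 0")
    case True
    then show ?thesis by (simp add: prob_space)
  next
    case False
    have "prob (\<Inter>t\<in>{1..m}. D t -` {d t} \<inter> space M) = (\<Prod>t\<in>{1..m}. prob (D t -` {d t} \<inter> space M))"
      using False by (intro indep_varsD[OF indep]) auto
    moreover have "(\<Inter>t\<in>{1..m}. D t -` {d t} \<inter> space M) = {\<omega> \<in> space M. \<forall>t\<in>{1..m}. D t \<omega> = d t}"
      using False by auto
    moreover have "D t -` {d t} \<inter> space M = {\<omega> \<in> space M. D t \<omega> = d t}" for t by auto
    ultimately show ?thesis by simp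
  qed
  show ?thesis unfolding path by simp
qed

text \<open>The independence assumption on the source prescribes channel states and actions along
  with the receptions. Summing over the finitely many channel-action paths removes them.\<close>

lemma source_reception_indep:
  "prob {\<omega> \<in> space M. \<forall>t\<in>{1..n}. X t \<omega> = x t \<and> D t \<omega> = d t} =
   prob {\<omega> \<in> space M. \<forall>t\<in>{1..n}. X t \<omega> = x t} * prob {\<omega> \<in> space M. \<forall>t\<in>{1..n}. D t \<omega> = d t}"
proof -
  define F :: "(nat \<Rightarrow> nat \<times> action) set" where "F = PiE {1..n} (\<lambda>_. {0, 1} \<times> UNIV)"
  define g where "g \<omega> = restrict (\<lambda>t. (h t \<omega>, A t \<omega>)) {1..n}" for \<omega>
  have F: "finite F" unfolding F_def by (intro finite_PiE finite_cartesian_product finite_action) auto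
  have gF: "g \<omega> \<in> F" if "\<omega> \<in> space M" for \<omega>
    using channel_states[OF _ that] by (auto simp: g_def F_def)
  have g_eq: "g \<omega> = y \<longleftrightarrow> (\<forall>t\<in>{1..n}. h t \<omega> = fst (y t) \<and> A t \<omega> = snd (y t))" if "y \<in> F" for y \<omega>
    using that unfolding g_def F_def by (intro restrict_pair_eq_iff) (simp add: PiE_def)
  have g_event: "{\<omega> \<in> space M. g \<omega> = y} \<in> events" if "y \<in> F" for y
    using path_event[where Q="\<lambda>_ _. True" and R="\<lambda>t c a _. c = fst (y t) \<and> a = snd (y t)"]
    by (simp add: g_eq[OF that])
  \<comment> \<open>Arbitrary \<open>Q\<close> and \<open>R\<close> serve two uses: the joint event,
    and, with trivial \<open>Q\<close>, reassembling the law of the receptions alone.\<close>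
  have split: "prob {\<omega> \<in> space M. \<forall>t\<in>{1..n}. Q t (X t \<omega>) \<and> R t (D t \<omega>)} =
      (\<Sum>y\<in>F. prob {\<omega> \<in> space M. \<forall>t\<in>{1..n}.
         Q t (X t \<omega>) \<and> h t \<omega> = fst (y t) \<and> A t \<omega> = snd (y t) \<and> R t (D t \<omega>)})" for Q R
    using F gF g_event path_event[where Q=Q and R="\<lambda>t _ _ d. R t d"]
    by (subst measure_eq_sum_fibres[where F=F and g=g])
      (auto intro!: sum.cong arg_cong[where f=prob] simp: g_eq)
  have "prob {\<omega> \<in> space M. \<forall>t\<in>{1..n}. X t \<omega> = x t \<and> D t \<omega> = d t} =
    (\<Sum>y\<in>F. prob {\<omega> \<in> space M. \<forall>t\<in>{1..n}. X t \<omega> = x t} *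
      prob {\<omega> \<in> space M. \<forall>t\<in>{1..n}. h t \<omega> = fst (y t) \<and> A t \<omega> = snd (y t) \<and> D t \<omega> = d t})"
    unfolding split[of "\<lambda>t i. i = x t" "\<lambda>t e. e = d t"] by (simp only: source_indep)
  also have "\<dots> = prob {\<omega> \<in> space M. \<forall>t\<in>{1..n}. X t \<omega> = x t} *
      prob {\<omega> \<in> space M. \<forall>t\<in>{1..n}. D t \<omega> = d t}"
    using split[of "\<lambda>_ _. True" "\<lambda>t e. e = d t"] by (simp add: sum_distrib_left)
  finally show ?thesis .
qed

lemma source_reception_path_Suc:
  assumes "1 \<le> n" "\<And>t. x t \<in> {0, 1}"
  shows "prob {\<omega> \<in> space M. \<forall>t\<in>{1..Suc n}. X t \<omega> = x t \<and> D t \<omega> = d t} =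
    prob {\<omega> \<in> space M. \<forall>t\<in>{1..n}. X t \<omega> = x t \<and> D t \<omega> = d t} *
    (pX (x n) (x (Suc n)) * prob {\<omega> \<in> space M. D (Suc n) \<omega> = d (Suc n)})"
proof -
  have "prob {\<omega> \<in> space M. \<forall>t\<in>{1..Suc n}. X t \<omega> = x t} =
      prob {\<omega> \<in> space M. \<forall>t\<in>{1..n}. X t \<omega> = x t} * pX (x n) (x (Suc n))"
    using source assms by (simp add: two_state_markov_chain_def)
  then show ?thesis unfolding source_reception_indep reception_path_Suc by simp
qed

section \<open>Functions of the history and their one-step expectations\<close>

text \<open>Being determined by the first \<open>n\<close> slots. As these have only finitely many
  possible histories, the pointwise condition takes the place of measurability for the history
  sigma-algebra.\<close>

definition history_fun :: "nat \<Rightarrow> ('w \<Rightarrow> real) \<Rightarrow> bool" where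
  "history_fun n f \<longleftrightarrow>
     (\<forall>\<omega>\<in>space M. \<forall>\<omega>'\<in>space M. (\<forall>t\<in>{1..n}. X t \<omega> = X t \<omega>' \<and> D t \<omega> = D t \<omega>') \<longrightarrow> f \<omega> = f \<omega>')"

text \<open>The space splits into finitely many cells, one for each path up to \<open>n\<close>, and
  \<open>f\<close> is constant on each of them; \<open>v\<close> collects the constants.\<close>

lemma history_fun_decompose:
  assumes "history_fun n f"
  obtains F :: "(nat \<Rightarrow> nat \<times> bool) set" and v where "finite F"
    and "\<And>y t. y \<in> F \<Longrightarrow> 1 \<le> t \<Longrightarrow> t \<le> n \<Longrightarrow> fst (y t) = 0 \<or> fst (y t) = 1"
    and "\<And>\<omega>. \<omega> \<in> space M \<Longrightarrow> f \<omega> = (\<Sum>y\<in>F. v y *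
      indicator {\<omega> \<in> space M. \<forall>t\<in>{1..n}. X t \<omega> = fst (y t) \<and> D t \<omega> = snd (y t)} \<omega>)"
proof -
  define F :: "(nat \<Rightarrow> nat \<times> bool) set" where "F = PiE {1..n} (\<lambda>_. {0, 1} \<times> UNIV)"
  define g where "g \<omega> = restrict (\<lambda>t. (X t \<omega>, D t \<omega>)) {1..n}" for \<omega>
  \<comment> \<open>The value of \<open>f\<close> at a representative of the cell. For a path that
    never occurs the choice is arbitrary, but there the indicator vanishes.\<close>
  define v where "v y = f (SOME \<omega>. \<omega> \<in> space M \<and> g \<omega> = y)" for y
  have F: "finite F" unfolding F_def by (intro finite_PiE finite_cartesian_product) auto
  have gF: "g \<omega> \<in> F" if "\<omega> \<in> space M" for \<omega>
    using source_states[OF _ that] by (auto simp: g_def F_def)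
  have g_eq: "g \<omega> = y \<longleftrightarrow> (\<forall>t\<in>{1..n}. X t \<omega> = fst (y t) \<and> D t \<omega> = snd (y t))" if "y \<in> F" for y \<omega>
    using that unfolding g_def F_def by (intro restrict_pair_eq_iff) (simp add: PiE_def)
  have v: "v (g \<omega>) = f \<omega>" if "\<omega> \<in> space M" for \<omega>
  proof -
    define \<omega>' where "\<omega>' = (SOME \<omega>'. \<omega>' \<in> space M \<and> g \<omega>' = g \<omega>)"
    have *: "\<omega>' \<in> space M \<and> g \<omega>' = g \<omega>"
      unfolding \<omega>'_def by (rule someI[where x=\<omega>]) (simp add: that)
    then have "X t \<omega>' = X t \<omega> \<and> D t \<omega>' = D t \<omega>" if "t \<in> {1..n}" for t
      using * that by (auto simp: g_def dest: fun_cong[where x=t])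
    then have "f \<omega>' = f \<omega>" using assms * that unfolding history_fun_def by blast
    then show ?thesis by (simp add: v_def \<omega>'_def)
  qed
  show ?thesis
  proof
    show "finite F" by (fact F)
    show "fst (y t) = 0 \<or> fst (y t) = 1" if "y \<in> F" "1 \<le> t" "t \<le> n" for y t
      using PiE_mem[of y "{1..n}" "\<lambda>_. {0, 1} \<times> UNIV" t] that by (auto simp: F_def)
    show "f \<omega> = (\<Sum>y\<in>F. v y *
      indicator {\<omega> \<in> space M. \<forall>t\<in>{1..n}. X t \<omega> = fst (y t) \<and> D t \<omega> = snd (y t)} \<omega>)"
      if \<omega>: "\<omega> \<in> space M" for \<omega>
    proof -
      have "f \<omega> = (\<Sum>y\<in>F. if g \<omega> = y then v y else 0)"
        using F gF[OF \<omega>] by (simp add: v[OF \<omega>])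
      also have "\<dots> = (\<Sum>y\<in>F. v y *
          indicator {\<omega> \<in> space M. \<forall>t\<in>{1..n}. X t \<omega> = fst (y t) \<and> D t \<omega> = snd (y t)} \<omega>)"
        using \<omega> by (intro sum.cong refl) (auto simp: g_eq indicator_def)
      finally show ?thesis .
    qed
  qed
qed

lemma history_path_event:
  "{\<omega> \<in> space M. \<forall>t\<in>{1..n}. X t \<omega> = x t \<and> D t \<omega> = d t} \<in> events"
  using path_event[where Q="\<lambda>t i. i = x t" and R="\<lambda>t _ _ e. e = d t"] by simp

lemma history_fun_integrable:
  assumes "history_fun n f"
  shows "integrable M f"
proof -
  obtain F :: "(nat \<Rightarrow> nat \<times> bool) set" and v where "finite F" and
    "\<And>y t. y \<in> F \<Longrightarrow> 1 \<le> t \<Longrightarrow> t \<le> n \<Longrightarrow> fst (y t) = 0 \<or> fst (y t) = 1" and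
    f: "\<And>\<omega>. \<omega> \<in> space M \<Longrightarrow> f \<omega> = (\<Sum>y\<in>F. v y *
      indicator {\<omega> \<in> space M. \<forall>t\<in>{1..n}. X t \<omega> = fst (y t) \<and> D t \<omega> = snd (y t)} \<omega>)"
    by (rule history_fun_decompose[OF assms]) (rule that)
  show ?thesis
    by (rule Bochner_Integration.integrable_cong[THEN iffD2, OF refl f], assumption)
      (auto intro!: Bochner_Integration.integrable_sum integrable_mult_right
         integrable_real_indicator history_path_event[unfolded One_nat_def] simp: emeasure_eq_measure)
qed

text \<open>By linearity it suffices to take the indicator of one path, for which
  \<open>source_reception_path_Suc\<close> splits off both factors. This is conditioning on the
  history in integrated form, without dividing by the probability of a path.\<close>

lemma expectation_history_Suc:
  assumes "1 \<le> n" and f: "history_fun n f" and i: "i \<in> {0, 1}"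
  shows "expectation (\<lambda>\<omega>. of_bool (X (Suc n) \<omega> = i \<and> D (Suc n) \<omega> = e) * f \<omega>) =
    prob {\<omega> \<in> space M. D (Suc n) \<omega> = e} * expectation (\<lambda>\<omega>. pX (X n \<omega>) i * f \<omega>)"
proof -
  obtain F :: "(nat \<Rightarrow> nat \<times> bool) set" and v where "finite F" and
    F: "\<And>y t. y \<in> F \<Longrightarrow> 1 \<le> t \<Longrightarrow> t \<le> n \<Longrightarrow> fst (y t) = 0 \<or> fst (y t) = 1" and
    f: "\<And>\<omega>. \<omega> \<in> space M \<Longrightarrow> f \<omega> = (\<Sum>y\<in>F. v y *
      indicator {\<omega> \<in> space M. \<forall>t\<in>{1..n}. X t \<omega> = fst (y t) \<and> D t \<omega> = snd (y t)} \<omega>)"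
    by (rule history_fun_decompose[OF f]) (rule that)
  define S where "S y = {\<omega> \<in> space M. \<forall>t\<in>{1..n}. X t \<omega> = fst (y t) \<and> D t \<omega> = snd (y t)}"
    for y :: "nat \<Rightarrow> nat \<times> bool"
  define S' where "S' y = {\<omega> \<in> S y. X (Suc n) \<omega> = i \<and> D (Suc n) \<omega> = e}"
    for y :: "nat \<Rightarrow> nat \<times> bool"
  have S: "S y \<in> events" for y unfolding S_def by (rule history_path_event)
  \<comment> \<open>The path is continued by \<open>i\<close> and \<open>e\<close> at every index
    outside \<open>{1..n}\<close>, index 0 included, because
    \<open>source_reception_path_Suc\<close> asks for source values in \<open>{0, 1}\<close> at all
    indices.\<close>
  have S'_eq: "S' y = {\<omega> \<in> space M. \<forall>t\<in>{1..Suc n}.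
      X t \<omega> = ((\<lambda>t. if t \<in> {1..n} then fst (y t) else i) t) \<and>
      D t \<omega> = ((\<lambda>t. if t \<in> {1..n} then snd (y t) else e) t)}" for y
    by (auto simp: S'_def S_def atLeastAtMostSuc_conv)
  have S_n: "fst (y n) = X n \<omega>" if "\<omega> \<in> S y" for y \<omega>
    using that assms(1) by (auto simp: S_def)
  have S': "S' y \<in> events" for y unfolding S'_eq by (rule history_path_event)
  have prob_S': "prob (S' y) = prob (S y) * (pX (fst (y n)) i * prob {\<omega> \<in> space M. D (Suc n) \<omega> = e})"
    if "y \<in> F" for y
    unfolding S'_eq
    by (subst source_reception_path_Suc) (use assms(1) i F[OF that] in \<open>auto simp: S_def\<close>)
  have int: "integrable M (indicat_real (S y))" "integrable M (indicat_real (S' y))" for y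
    using S S' by (auto intro!: integrable_real_indicator simp: emeasure_eq_measure)
  have "expectation (\<lambda>\<omega>. of_bool (X (Suc n) \<omega> = i \<and> D (Suc n) \<omega> = e) * f \<omega>) =
      expectation (\<lambda>\<omega>. \<Sum>y\<in>F. v y * indicator (S' y) \<omega>)"
    by (intro Bochner_Integration.integral_cong refl)
      (auto simp: f sum_distrib_left S'_def S_def indicator_def intro!: sum.cong)
  also have "\<dots> = (\<Sum>y\<in>F. v y * prob (S' y))"
    using S' by (subst Bochner_Integration.integral_sum) (auto simp: int)
  also have "\<dots> = prob {\<omega> \<in> space M. D (Suc n) \<omega> = e} * (\<Sum>y\<in>F. pX (fst (y n)) i * v y * prob (S y))"
    by (simp add: prob_S' sum_distrib_left ac_simps)
  also have "(\<Sum>y\<in>F. pX (fst (y n)) i * v y * prob (S y)) =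
      expectation (\<lambda>\<omega>. \<Sum>y\<in>F. (pX (fst (y n)) i * v y) * indicator (S y) \<omega>)"
    using S by (subst Bochner_Integration.integral_sum) (auto simp: int)
  also have "\<dots> = expectation (\<lambda>\<omega>. pX (X n \<omega>) i * f \<omega>)"
    by (intro Bochner_Integration.integral_cong refl)
      (auto simp: f[folded S_def] sum_distrib_left S_n indicator_def intro!: sum.cong)
  finally show ?thesis .
qed

lemma history_fun_slot:
  assumes "1 \<le> n"
  shows "history_fun n (\<lambda>\<omega>. \<phi> (X n \<omega>) (D n \<omega>))"
  unfolding history_fun_def
proof (intro ballI impI)
  fix \<omega> \<omega>' assume "\<forall>t\<in>{1..n}. X t \<omega> = X t \<omega>' \<and> D t \<omega> = D t \<omega>'"
  then have "X n \<omega> = X n \<omega>' \<and> D n \<omega> = D n \<omega>'" by (rule bspec) (use assms in simp)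
  then show "\<phi> (X n \<omega>) (D n \<omega>) = \<phi> (X n \<omega>') (D n \<omega>')" by simp
qed

lemma history_fun_estimate: "history_fun n (\<lambda>\<omega>. \<phi> (estimate x0 X D n \<omega>))"
  unfolding history_fun_def
proof (intro ballI impI)
  fix \<omega> \<omega>' assume "\<forall>t\<in>{1..n}. X t \<omega> = X t \<omega>' \<and> D t \<omega> = D t \<omega>'"
  then have "estimate x0 X D n \<omega> = estimate x0 X D n \<omega>'" by (intro estimate_cong) (rule bspec)
  then show "\<phi> (estimate x0 X D n \<omega>) = \<phi> (estimate x0 X D n \<omega>')" by simp
qed

lemma history_fun_aoi1: "history_fun n (\<lambda>\<omega>. \<phi> (aoi1 a0 x0 X D (Suc n) \<omega>))"
  unfolding history_fun_def
proof (intro ballI impI)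
  fix \<omega> \<omega>' assume "\<forall>t\<in>{1..n}. X t \<omega> = X t \<omega>' \<and> D t \<omega> = D t \<omega>'"
  then have "aoi1 a0 x0 X D (Suc n) \<omega> = aoi1 a0 x0 X D (Suc n) \<omega>'"
    by (intro aoi1_cong) (erule bspec, simp)
  then show "\<phi> (aoi1 a0 x0 X D (Suc n) \<omega>) = \<phi> (aoi1 a0 x0 X D (Suc n) \<omega>')" by (rule arg_cong)
qed

lemma history_fun_combine:
  fixes F :: "real \<Rightarrow> real \<Rightarrow> real"
  assumes f: "history_fun n f" and g: "history_fun n g"
  shows "history_fun n (\<lambda>\<omega>. F (f \<omega>) (g \<omega>))"
  unfolding history_fun_def
proof (intro ballI impI)
  fix \<omega> \<omega>' assume *: "\<omega> \<in> space M" "\<omega>' \<in> space M"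
    "\<forall>t\<in>{1..n}. X t \<omega> = X t \<omega>' \<and> D t \<omega> = D t \<omega>'"
  have "f \<omega> = f \<omega>'" using f[unfolded history_fun_def, rule_format, OF *(1,2)] *(3) by blast
  moreover have "g \<omega> = g \<omega>'" using g[unfolded history_fun_def, rule_format, OF *(1,2)] *(3) by blast
  ultimately show "F (f \<omega>) (g \<omega>) = F (f \<omega>') (g \<omega>')" by simp
qed

lemma history_fun_Suc:
  assumes "history_fun n f"
  shows "history_fun (Suc n) f"
  unfolding history_fun_def
proof (intro ballI impI)
  fix \<omega> \<omega>' assume *: "\<omega> \<in> space M" "\<omega>' \<in> space M"
    and "\<forall>t\<in>{1..Suc n}. X t \<omega> = X t \<omega>' \<and> D t \<omega> = D t \<omega>'"
  then have "\<forall>t\<in>{1..n}. X t \<omega> = X t \<omega>' \<and> D t \<omega> = D t \<omega>'" by simp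
  then show "f \<omega> = f \<omega>'" using assms[unfolded history_fun_def, rule_format, OF *] by blast
qed

text \<open>Splits according to the four values of source and reception in slot
  \<open>Suc n\<close>. That slot enters only through the arguments of \<open>f\<close>, while each
  \<open>f i e\<close> depends on the history up to \<open>n\<close>; the recursions below come from
  suitable choices of \<open>f\<close>.\<close>

lemma expectation_Suc:
  assumes "1 \<le> n" and f: "\<And>i e. history_fun n (f i e)"
  shows "expectation (\<lambda>\<omega>. f (X (Suc n) \<omega>) (D (Suc n) \<omega>) \<omega>) =
    expectation (\<lambda>\<omega>. \<Sum>i\<in>{0, 1}. pX (X n \<omega>) i *
      (success_prob ph p1r p0p p1 p3 * f i True \<omega> +
       (1 - success_prob ph p1r p0p p1 p3) * f i False \<omega>))"
proof -
  \<comment> \<open>The indicator looks at slot \<open>Suc n\<close>, so this product is treated as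
    a history function of \<open>Suc n\<close>, not of \<open>n\<close>.\<close>
  have int: "integrable M (\<lambda>\<omega>. of_bool (X (Suc n) \<omega> = i \<and> D (Suc n) \<omega> = e) * f i e \<omega>)" for i e
    by (rule history_fun_integrable[OF history_fun_combine[where F="(*)",
          OF history_fun_slot[where \<phi>="\<lambda>x d. of_bool (x = i \<and> d = e)"] history_fun_Suc[OF f]]]) simp
  have int': "integrable M (\<lambda>\<omega>. pX (X n \<omega>) i * f i e \<omega>)" for i e
    by (rule history_fun_integrable[OF history_fun_combine[where F="(*)",
          OF history_fun_slot[where \<phi>="\<lambda>x _. pX x i", OF assms(1)] f]])
  have "expectation (\<lambda>\<omega>. f (X (Suc n) \<omega>) (D (Suc n) \<omega>) \<omega>) =
      expectation (\<lambda>\<omega>. \<Sum>i\<in>{0, 1}. \<Sum>e\<in>UNIV.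
        of_bool (X (Suc n) \<omega> = i \<and> D (Suc n) \<omega> = e) * f i e \<omega>)"
  proof (intro Bochner_Integration.integral_cong refl)
    fix \<omega> assume "\<omega> \<in> space M"
    then show "f (X (Suc n) \<omega>) (D (Suc n) \<omega>) \<omega> = (\<Sum>i\<in>{0, 1}. \<Sum>e\<in>UNIV.
        of_bool (X (Suc n) \<omega> = i \<and> D (Suc n) \<omega> = e) * f i e \<omega>)"
      using source_states[of "Suc n" \<omega>] by (cases "D (Suc n) \<omega>") (auto simp: UNIV_bool)
  qed
  also have "\<dots> = (\<Sum>i\<in>{0, 1}. \<Sum>e\<in>UNIV.
      expectation (\<lambda>\<omega>. of_bool (X (Suc n) \<omega> = i \<and> D (Suc n) \<omega> = e) * f i e \<omega>))"
    by (simp only: Bochner_Integration.integral_sum Bochner_Integration.integrable_sum int)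
  also have "\<dots> = (\<Sum>i\<in>{0, 1}. \<Sum>e\<in>UNIV.
      prob {\<omega> \<in> space M. D (Suc n) \<omega> = e} * expectation (\<lambda>\<omega>. pX (X n \<omega>) i * f i e \<omega>))"
    by (intro sum.cong refl expectation_history_Suc assms)
  also have "\<dots> = expectation (\<lambda>\<omega>. \<Sum>i\<in>{0, 1}. \<Sum>e\<in>UNIV.
      prob {\<omega> \<in> space M. D (Suc n) \<omega> = e} * (pX (X n \<omega>) i * f i e \<omega>))"
    by (simp add: Bochner_Integration.integral_sum Bochner_Integration.integrable_sum int'
        integrable_mult_right)
  finally show ?thesis
    by (simp add: UNIV_bool prob_reception_eq algebra_simps)
qed

lemma estimate_states:
  assumes "x0 \<in> {0, 1}" "\<omega> \<in> space M"
  shows "estimate x0 X D t \<omega> = 0 \<or> estimate x0 X D t \<omega> = 1"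
proof (induction t)
  case 0
  then show ?case using assms(1) by (auto simp: estimate_def)
next
  case (Suc t)
  then show ?case using source_states[of "Suc t" \<omega>] assms(2) by (simp add: estimate_Suc)
qed

text \<open>Holds for every predicate: if it does not define an event, both sides are 0 by
  convention.\<close>

lemma prob_eq_expectation: "prob {\<omega> \<in> space M. P \<omega>} = expectation (\<lambda>\<omega>. of_bool (P \<omega>))"
proof -
  have "expectation (\<lambda>\<omega>. of_bool (P \<omega>)) = expectation (indicator {\<omega> \<in> space M. P \<omega>})"
    by (intro Bochner_Integration.integral_cong refl) (simp add: indicator_def)
  also have "\<dots> = prob ({\<omega> \<in> space M. P \<omega>} \<inter> space M)" by simp
  finally show ?thesis by (simp add: Int_absorb2)
qed

subsection \<open>Recursions between consecutive slots\<close>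

text \<open>The recursions for the estimate and the age produce the right-hand side; this identifies
  it as a probability in the next slot.\<close>

lemma prob_source_Suc_eq_expectation:
  assumes "1 \<le> n"
  shows "prob {\<omega> \<in> space M. X (Suc n) \<omega> = 0} = expectation (\<lambda>\<omega>. pX (X n \<omega>) 0)"
  unfolding prob_eq_expectation
  by (subst expectation_Suc[OF assms, where f="\<lambda>i _ _. of_bool (i = 0)"])
    (simp_all add: history_fun_def)

text \<open>On the two states, \<open>pX x 0\<close> is an affine function of the indicator of
  \<open>x = 0\<close>, which closes the recursion.\<close>

lemma prob_source_Suc:
  assumes "1 \<le> n"
  shows "prob {\<omega> \<in> space M. X (Suc n) \<omega> = 0} =
    (1 - pX 0 1 - pX 1 0) * prob {\<omega> \<in> space M. X n \<omega> = 0} + pX 1 0"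
proof -
  have "prob {\<omega> \<in> space M. X (Suc n) \<omega> = 0} = expectation (\<lambda>\<omega>. pX (X n \<omega>) 0)"
    by (rule prob_source_Suc_eq_expectation[OF assms])
  also have "\<dots> = expectation (\<lambda>\<omega>. (1 - pX 0 1 - pX 1 0) * of_bool (X n \<omega> = 0) + pX 1 0)"
    using source_states[OF assms]
    by (intro Bochner_Integration.integral_cong refl) (force simp: source_transition)
  also have "\<dots> = (1 - pX 0 1 - pX 1 0) * prob {\<omega> \<in> space M. X n \<omega> = 0} + pX 1 0"
    unfolding prob_eq_expectation
    using history_fun_integrable[OF history_fun_slot[OF assms, of "\<lambda>x _. of_bool (x = 0)"]]
    by (simp add: prob_space)
  finally show ?thesis .
qed

text \<open>The source appears at \<open>Suc n\<close> because a received sample already counts for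
  the estimate of its own slot.\<close>

lemma prob_estimate_Suc:
  assumes "1 \<le> n"
  shows "prob {\<omega> \<in> space M. estimate x0 X D (Suc n) \<omega> = 0} =
    (1 - success_prob ph p1r p0p p1 p3) * prob {\<omega> \<in> space M. estimate x0 X D n \<omega> = 0} +
    success_prob ph p1r p0p p1 p3 * prob {\<omega> \<in> space M. X (Suc n) \<omega> = 0}"
proof -
  let ?p = "success_prob ph p1r p0p p1 p3"
  have source_int: "integrable M (\<lambda>\<omega>. pX (X n \<omega>) 0)"
    by (rule history_fun_integrable[OF history_fun_slot[OF assms, of "\<lambda>x _. pX x 0"]])
  have estimate_int: "integrable M (\<lambda>\<omega>. of_bool (estimate x0 X D n \<omega> = 0) :: real)"
    by (rule history_fun_integrable[OF history_fun_estimate])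
  have "prob {\<omega> \<in> space M. estimate x0 X D (Suc n) \<omega> = 0} =
      expectation (\<lambda>\<omega>. \<Sum>i\<in>{0, 1}. pX (X n \<omega>) i *
        (?p * of_bool (i = 0) + (1 - ?p) * of_bool (estimate x0 X D n \<omega> = 0)))"
    unfolding prob_eq_expectation estimate_Suc
    using expectation_Suc[OF assms,
        where f="\<lambda>i e \<omega>. of_bool ((if e then i else estimate x0 X D n \<omega>) = 0)",
        OF history_fun_estimate[where \<phi>="\<lambda>y. of_bool ((if e then i else y) = 0)" for i e]]
    by (simp only: if_True if_False)
  also have "\<dots> = expectation (\<lambda>\<omega>. (1 - ?p) * of_bool (estimate x0 X D n \<omega> = 0) + ?p * pX (X n \<omega>) 0)"
  proof (intro Bochner_Integration.integral_cong refl)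
    fix \<omega> assume "\<omega> \<in> space M"
    then have pX_1: "pX (X n \<omega>) 1 = 1 - pX (X n \<omega>) 0"
      using source_states[OF assms, of \<omega>] by (auto simp: source_transition[unfolded One_nat_def])
    show "(\<Sum>i\<in>{0, 1}. pX (X n \<omega>) i *
        (?p * of_bool (i = 0) + (1 - ?p) * of_bool (estimate x0 X D n \<omega> = 0))) =
      (1 - ?p) * of_bool (estimate x0 X D n \<omega> = 0) + ?p * pX (X n \<omega>) 0"
      by (simp add: pX_1[unfolded One_nat_def], simp add: algebra_simps)
  qed
  also have "\<dots> = (1 - ?p) * expectation (\<lambda>\<omega>. of_bool (estimate x0 X D n \<omega> = 0)) +
      ?p * expectation (\<lambda>\<omega>. pX (X n \<omega>) 0)"
    using source_int estimate_int by simp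
  finally show ?thesis unfolding prob_source_Suc_eq_expectation[OF assms] prob_eq_expectation .
qed

text \<open>On states, \<open>1 - X t\<close> is the other state, so the weight is the probability
  of leaving. A mismatch in the next slot requires a failed reception, with the estimate kept. From
  a match the expected next weight is \<open>q * a * b\<close>; from a mismatch of weight
  \<open>u\<close> it is \<open>q * (1 - u) * u\<close>, and
  \<open>(1 - u) * u = c * u + a * b\<close> for \<open>u = a\<close> and
  \<open>u = b\<close>.\<close>

lemma weighted_mismatch_Suc:
  assumes "1 \<le> n" "x0 \<in> {0, 1}"
  defines "r \<equiv> \<lambda>t. expectation (\<lambda>\<omega>. pX (X t \<omega>) (1 - X t \<omega>) * distortion (X t \<omega>) (estimate x0 X D t \<omega>))"
  shows "r (Suc n) = (1 - success_prob ph p1r p0p p1 p3) * (1 - pX 0 1 - pX 1 0) * r n +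
    (1 - success_prob ph p1r p0p p1 p3) * (pX 0 1 * pX 1 0)"
proof -
  let ?q = "1 - success_prob ph p1r p0p p1 p3"
  have int: "integrable M (\<lambda>\<omega>. pX (X n \<omega>) (1 - X n \<omega>) * distortion (X n \<omega>) (estimate x0 X D n \<omega>))"
  proof -
    \<comment> \<open>Written with indicators, the distortion is a combination of history functions.
      The two forms agree on \<open>space M\<close>, where both arguments are 0 or 1.\<close>
    have "integrable M (\<lambda>\<omega>. pX (X n \<omega>) (1 - X n \<omega>) *
        \<bar>of_bool (X n \<omega> = 0) - of_bool (estimate x0 X D n \<omega> = 0)\<bar>)"
      by (rule history_fun_integrable[OF history_fun_combine[where F="(*)",
          OF history_fun_slot[where \<phi>="\<lambda>x _. pX x (1 - x)", OF assms(1)]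
          history_fun_combine[where F="\<lambda>x y. \<bar>x - y\<bar>", OF
            history_fun_slot[where \<phi>="\<lambda>x _. of_bool (x = 0)", OF assms(1)] history_fun_estimate]]])
    also have "?this \<longleftrightarrow> ?thesis"
      using source_states[OF assms(1)] estimate_states[OF assms(2), of _ n]
      by (intro Bochner_Integration.integrable_cong refl) (force simp: distortion_def)
    finally show ?thesis .
  qed
  have "r (Suc n) = expectation (\<lambda>\<omega>. \<Sum>i\<in>{0, 1}. pX (X n \<omega>) i *
      (success_prob ph p1r p0p p1 p3 * (pX i (1 - i) * distortion i i) +
       ?q * (pX i (1 - i) * distortion i (estimate x0 X D n \<omega>))))"
    unfolding r_def estimate_Suc
    using expectation_Suc[OF assms(1), where f="\<lambda>i e \<omega>.
        pX i (1 - i) * distortion i (if e then i else estimate x0 X D n \<omega>)",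
        OF history_fun_estimate[where \<phi>="\<lambda>y. pX i (1 - i) * distortion i (if e then i else y)" for i e]]
    by (simp only: if_True if_False)
  also have "\<dots> = expectation (\<lambda>\<omega>. ?q * (1 - pX 0 1 - pX 1 0) *
      (pX (X n \<omega>) (1 - X n \<omega>) * distortion (X n \<omega>) (estimate x0 X D n \<omega>)) + ?q * (pX 0 1 * pX 1 0))"
  proof (intro Bochner_Integration.integral_cong refl)
    fix \<omega> assume "\<omega> \<in> space M"
    then consider "X n \<omega> = 0" "estimate x0 X D n \<omega> = 0" | "X n \<omega> = 0" "estimate x0 X D n \<omega> = 1"
      | "X n \<omega> = 1" "estimate x0 X D n \<omega> = 0" | "X n \<omega> = 1" "estimate x0 X D n \<omega> = 1"
      using source_states[OF assms(1), of \<omega>] estimate_states[OF assms(2), of \<omega> n] by metis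
    then show "(\<Sum>i\<in>{0, 1}. pX (X n \<omega>) i *
      (success_prob ph p1r p0p p1 p3 * (pX i (1 - i) * distortion i i) +
       ?q * (pX i (1 - i) * distortion i (estimate x0 X D n \<omega>)))) =
      ?q * (1 - pX 0 1 - pX 1 0) *
      (pX (X n \<omega>) (1 - X n \<omega>) * distortion (X n \<omega>) (estimate x0 X D n \<omega>)) + ?q * (pX 0 1 * pX 1 0)"
      by cases (simp_all add: distortion_def source_transition[unfolded One_nat_def], simp_all add: algebra_simps)
  qed
  also have "\<dots> = ?q * (1 - pX 0 1 - pX 1 0) * r n + ?q * (pX 0 1 * pX 1 0)"
    unfolding r_def using int by (simp add: prob_space)
  finally show ?thesis .
qed

text \<open>A pointwise identity, integrated: for a match both sides vanish, while for a mismatch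
  \<open>(a + b) \<plusminus> (a - b)\<close> is twice the probability of leaving the current source
  state.\<close>

lemma expected_distortion_eq:
  assumes "1 \<le> n" "x0 \<in> {0, 1}"
  shows "(pX 0 1 + pX 1 0) * expectation (\<lambda>\<omega>. distortion (X n \<omega>) (estimate x0 X D n \<omega>)) =
    2 * expectation (\<lambda>\<omega>. pX (X n \<omega>) (1 - X n \<omega>) * distortion (X n \<omega>) (estimate x0 X D n \<omega>)) +
    (pX 0 1 - pX 1 0) *
      (prob {\<omega> \<in> space M. estimate x0 X D n \<omega> = 0} - prob {\<omega> \<in> space M. X n \<omega> = 0})"
proof -
  let ?E = "estimate x0 X D n"
  have X_int: "integrable M (\<lambda>\<omega>. of_bool (X n \<omega> = 0) :: real)"
    by (rule history_fun_integrable[OF history_fun_slot[OF assms(1), of "\<lambda>x _. of_bool (x = 0)"]])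
  have E_int: "integrable M (\<lambda>\<omega>. of_bool (?E \<omega> = 0) :: real)"
    by (rule history_fun_integrable[OF history_fun_estimate])
  have distortion_eq: "distortion (X n \<omega>) (?E \<omega>) = \<bar>of_bool (X n \<omega> = 0) - of_bool (?E \<omega> = 0)\<bar>"
    if "\<omega> \<in> space M" for \<omega>
    using source_states[OF assms(1) that] estimate_states[OF assms(2) that, of n]
    by (auto simp: distortion_def)
  have "integrable M (\<lambda>\<omega>. \<bar>of_bool (X n \<omega> = 0) - of_bool (?E \<omega> = 0)\<bar> :: real)"
    using X_int E_int by simp
  then have "integrable M (\<lambda>\<omega>. distortion (X n \<omega>) (?E \<omega>))"
    by (rule Bochner_Integration.integrable_cong[THEN iffD2, OF refl distortion_eq, rotated])
  have "expectation (\<lambda>\<omega>. (pX 0 1 + pX 1 0) * distortion (X n \<omega>) (?E \<omega>) -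
      (pX 0 1 - pX 1 0) * (of_bool (?E \<omega> = 0) - of_bool (X n \<omega> = 0))) =
    expectation (\<lambda>\<omega>. 2 * (pX (X n \<omega>) (1 - X n \<omega>) * distortion (X n \<omega>) (?E \<omega>)))"
  proof (intro Bochner_Integration.integral_cong refl)
    fix \<omega> assume "\<omega> \<in> space M"
    then show "(pX 0 1 + pX 1 0) * distortion (X n \<omega>) (?E \<omega>) -
        (pX 0 1 - pX 1 0) * (of_bool (?E \<omega> = 0) - of_bool (X n \<omega> = 0)) =
      2 * (pX (X n \<omega>) (1 - X n \<omega>) * distortion (X n \<omega>) (?E \<omega>))"
      using source_states[OF assms(1), of \<omega>] estimate_states[OF assms(2), of \<omega> n]
      by (auto simp: distortion_def)
  qed
  then show ?thesis
    using X_int E_int \<open>integrable M (\<lambda>\<omega>. distortion (X n \<omega>) (?E \<omega>))\<close>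
    unfolding prob_eq_expectation by simp
qed

text \<open>On a reception in slot \<open>Suc n\<close> the estimate is the fresh sample, so the age
  restarts at the indicator of \<open>X (Suc n) \<noteq> 0\<close>; otherwise it grows by 1. The age
  of slot \<open>Suc n\<close> depends only on the history up to \<open>n\<close>.\<close>

lemma expected_aoi1_Suc:
  assumes "1 \<le> n"
  shows "expectation (\<lambda>\<omega>. real (aoi1 a0 x0 X D (Suc (Suc n)) \<omega>)) =
    (1 - success_prob ph p1r p0p p1 p3) * expectation (\<lambda>\<omega>. real (aoi1 a0 x0 X D (Suc n) \<omega>)) +
    ((1 - success_prob ph p1r p0p p1 p3) +
     success_prob ph p1r p0p p1 p3 * (1 - prob {\<omega> \<in> space M. X (Suc n) \<omega> = 0}))"
proof -
  let ?p = "success_prob ph p1r p0p p1 p3"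
  let ?a = "aoi1 a0 x0 X D (Suc n)"
  have source_int: "integrable M (\<lambda>\<omega>. pX (X n \<omega>) 0)"
    by (rule history_fun_integrable[OF history_fun_slot[OF assms, of "\<lambda>x _. pX x 0"]])
  have age_int: "integrable M (\<lambda>\<omega>. real (?a \<omega>))"
    by (rule history_fun_integrable[OF history_fun_aoi1])
  have "expectation (\<lambda>\<omega>. real (aoi1 a0 x0 X D (Suc (Suc n)) \<omega>)) =
      expectation (\<lambda>\<omega>. if D (Suc n) \<omega> then of_bool (X (Suc n) \<omega> \<noteq> 0) else real (?a \<omega>) + 1)"
    by (intro Bochner_Integration.integral_cong refl) (simp add: estimate_Suc)
  also have "\<dots> = expectation (\<lambda>\<omega>. \<Sum>i\<in>{0, 1}. pX (X n \<omega>) i *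
        (?p * of_bool (i \<noteq> 0) + (1 - ?p) * (real (?a \<omega>) + 1)))"
    using expectation_Suc[OF assms,
        where f="\<lambda>i e \<omega>. if e then of_bool (i \<noteq> 0) else real (?a \<omega>) + 1",
        OF history_fun_aoi1[where \<phi>="\<lambda>a. if e then of_bool (i \<noteq> 0) else real a + 1" for i e]]
    by (simp only: if_True if_False)
  also have "\<dots> = expectation (\<lambda>\<omega>. (1 - ?p) * (real (?a \<omega>) + 1) + ?p * (1 - pX (X n \<omega>) 0))"
  proof (intro Bochner_Integration.integral_cong refl)
    fix \<omega> assume "\<omega> \<in> space M"
    then have pX_1: "pX (X n \<omega>) 1 = 1 - pX (X n \<omega>) 0"
      using source_states[OF assms, of \<omega>] by (auto simp: source_transition[unfolded One_nat_def])
    show "(\<Sum>i\<in>{0, 1}. pX (X n \<omega>) i * (?p * of_bool (i \<noteq> 0) + (1 - ?p) * (real (?a \<omega>) + 1))) =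
      (1 - ?p) * (real (?a \<omega>) + 1) + ?p * (1 - pX (X n \<omega>) 0)"
      by (simp add: pX_1[unfolded One_nat_def] del: aoi1.simps, simp add: algebra_simps del: aoi1.simps)
  qed
  also have "\<dots> = (1 - ?p) * (expectation (\<lambda>\<omega>. real (?a \<omega>)) + 1) +
      ?p * (1 - expectation (\<lambda>\<omega>. pX (X n \<omega>) 0))"
    using source_int age_int by (simp add: prob_space del: aoi1.simps)
  finally show ?thesis unfolding prob_source_Suc_eq_expectation[OF assms] by (simp add: algebra_simps del: aoi1.simps)
qed

end

section \<open>Limits of the distortion and of the age\<close>

text \<open>For a source that flips in every slot, \<open>P(X = 0)\<close> may alternate, and then
  \<open>P(estimate = 0)\<close> has no limit. Its convergence is therefore claimed outside this
  case, and the age limit is stated relative to a given limit; the distortion converges in all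
  cases.\<close>

theorem theorem1:
  fixes M :: "'w measure"
    and X h :: "nat \<Rightarrow> 'w \<Rightarrow> nat"
    and A :: "nat \<Rightarrow> 'w \<Rightarrow> action"
    and D :: "nat \<Rightarrow> 'w \<Rightarrow> bool"
    and pX ph :: "nat \<Rightarrow> nat \<Rightarrow> real"
    and p1r p0p p0 p1 p2 p3 p_s :: real
    and x0 a0 :: nat
  assumes "srp_system M X h A D pX ph p1r p0p p0 p1 p2 p3"
    and "p_s = success_prob ph p1r p0p p1 p3"
    and "0 < p_s"
    and "x0 \<in> {0, 1}"
  shows
    "(\<forall>t\<ge>1. measure M {\<omega> \<in> space M. D t \<omega>} = p_s) \<and>
     (\<lambda>t. \<integral>\<omega>. distortion (X t \<omega>) (estimate x0 X D t \<omega>) \<partial>M) \<longlonglongrightarrow>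
       2 * (1 - p_s) * pX 1 0 * pX 0 1 /
       ((pX 0 1 + pX 1 0) * (1 + (1 - p_s) * (pX 1 0 - pX 0 0))) \<and>
     (\<not> (pX 0 1 = 1 \<and> pX 1 0 = 1) \<longrightarrow>
       convergent (\<lambda>t. measure M {\<omega> \<in> space M. estimate x0 X D t \<omega> = 0})) \<and>
     (\<forall>q. (\<lambda>t. measure M {\<omega> \<in> space M. estimate x0 X D t \<omega> = 0}) \<longlonglongrightarrow> q \<longrightarrow>
       (\<lambda>t. \<integral>\<omega>. real (aoi1 a0 x0 X D t \<omega>) \<partial>M) \<longlonglongrightarrow> 1 / p_s * (1 - p_s * q))"
proof -
  interpret srp_system M X h A D pX ph p1r p0p p0 p1 p2 p3 by fact
  define q c where "q = 1 - p_s" and "c = 1 - pX 0 1 - pX 1 0"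
  define x where "x t = prob {\<omega> \<in> space M. X t \<omega> = 0}" for t
  define w where "w t = prob {\<omega> \<in> space M. estimate x0 X D t \<omega> = 0}" for t
  define r where
    "r t = expectation (\<lambda>\<omega>. pX (X t \<omega>) (1 - X t \<omega>) * distortion (X t \<omega>) (estimate x0 X D t \<omega>))" for t
  define d where "d t = expectation (\<lambda>\<omega>. distortion (X t \<omega>) (estimate x0 X D t \<omega>))" for t
  define m where "m t = expectation (\<lambda>\<omega>. real (aoi1 a0 x0 X D t \<omega>))" for t
  have received: "prob {\<omega> \<in> space M. D t \<omega>} = p_s" if "1 \<le> t" for t
    using prob_reception[OF that] assms(2) by simp
  have "p_s \<le> 1" using received[of 1] prob_le_1 by (metis order_refl)
  then have q: "0 \<le> q" "q < 1" using \<open>0 < p_s\<close> by (auto simp: q_def)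
  have c: "\<bar>c\<bar> \<le> 1"
    using source_transition source_steady by (simp add: c_def)
  have x_Suc: "x (Suc n) = c * x n + pX 1 0" if "1 \<le> n" for n
    using prob_source_Suc[OF that] by (simp add: x_def c_def)
  have w_Suc: "w (Suc n) = q * w n + p_s * x (Suc n)" if "1 \<le> n" for n
    using prob_estimate_Suc[OF that] assms(2) by (simp add: w_def x_def q_def)
  have r_Suc: "r (Suc n) = q * c * r n + q * (pX 0 1 * pX 1 0)" if "1 \<le> n" for n
    using weighted_mismatch_Suc[OF that assms(4)] assms(2) by (simp add: r_def q_def c_def)
  have d_eq: "d n = (2 * r n + (pX 0 1 - pX 1 0) * (w n - x n)) / (pX 0 1 + pX 1 0)" if "1 \<le> n" for n
    using expected_distortion_eq[OF that assms(4)] source_steady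
    by (simp add: d_def r_def w_def x_def field_simps)
  \<comment> \<open>The range starts at 2 because \<open>expected_aoi1_Suc\<close> is applied at
    \<open>n - 1\<close>, which has to be a slot.\<close>
  have m_Suc: "m (Suc n) = q * m n + (q + p_s * (1 - x n))" if "2 \<le> n" for n
    using expected_aoi1_Suc[of "n - 1" a0 x0] that assms(2)
    by (simp add: m_def x_def q_def Suc_diff_le del: aoi1.simps)
  have limits: "x \<longlonglongrightarrow> pX 1 0 / (1 - c)" "w \<longlonglongrightarrow> pX 1 0 / (1 - c)" if "\<not> (pX 0 1 = 1 \<and> pX 1 0 = 1)"
  proof -
    \<comment> \<open>Since \<open>0 < a + b \<le> 2\<close>, the value \<open>c = 1 - a - b\<close>
      reaches modulus 1 only for \<open>a = b = 1\<close>.\<close>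
    have "\<bar>c\<bar> < 1" using source_transition source_steady that by (auto simp: c_def)
    then show x: "x \<longlonglongrightarrow> pX 1 0 / (1 - c)"
      by (rule affine_recursion_tendsto[where N=1]) (use x_Suc in auto)
    have "(\<lambda>n. p_s * x (Suc n)) \<longlonglongrightarrow> p_s * (pX 1 0 / (1 - c))"
      by (intro tendsto_mult_left LIMSEQ_Suc x)
    then have "w \<longlonglongrightarrow> p_s * (pX 1 0 / (1 - c)) / (1 - q)"
      by (rule affine_recursion_tendsto[where N=1, rotated 2]) (use q w_Suc in auto)
    then show "w \<longlonglongrightarrow> pX 1 0 / (1 - c)" using \<open>0 < p_s\<close> by (simp add: q_def)
  qed
  have "d \<longlonglongrightarrow> 2 * (1 - p_s) * pX 1 0 * pX 0 1 /
       ((pX 0 1 + pX 1 0) * (1 + (1 - p_s) * (pX 1 0 - pX 0 0)))"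
  proof -
    \<comment> \<open>The factor \<open>q < 1\<close> keeps this recursion contracting even for
      \<open>c = -1\<close>, the periodic source.\<close>
    have "\<bar>q * c\<bar> \<le> q" using q c by (simp add: abs_mult mult_left_le)
    then have "\<bar>q * c\<bar> < 1" using q by simp
    then have "r \<longlonglongrightarrow> q * (pX 0 1 * pX 1 0) / (1 - q * c)"
      by (rule affine_recursion_tendsto[where N=1]) (use r_Suc in auto)
    moreover have "(\<lambda>n. (pX 0 1 - pX 1 0) * (w n - x n)) \<longlonglongrightarrow> 0"
    proof (cases "pX 0 1 = 1 \<and> pX 1 0 = 1")
      case False
      then show ?thesis using tendsto_diff[OF limits(2,1)] by (intro tendsto_mult_right_zero) simp_all
    qed simp
    ultimately have "(\<lambda>n. (2 * r n + (pX 0 1 - pX 1 0) * (w n - x n)) / (pX 0 1 + pX 1 0)) \<longlonglongrightarrow>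
        (2 * (q * (pX 0 1 * pX 1 0) / (1 - q * c)) + 0) / (pX 0 1 + pX 1 0)"
      using source_steady by (intro tendsto_intros) auto
    moreover have "(\<forall>\<^sub>F n in sequentially. (2 * r n + (pX 0 1 - pX 1 0) * (w n - x n)) / (pX 0 1 + pX 1 0) = d n)"
      using d_eq by (intro eventually_sequentiallyI[of 1]) simp
    ultimately have "d \<longlonglongrightarrow> (2 * (q * (pX 0 1 * pX 1 0) / (1 - q * c)) + 0) / (pX 0 1 + pX 1 0)"
      by (rule Lim_transform_eventually)
    moreover have denominator: "1 + (1 - p_s) * (pX 1 0 - pX 0 0) = 1 - q * c"
      by (simp add: q_def c_def source_transition algebra_simps)
    have "(2 * (q * (pX 0 1 * pX 1 0) / (1 - q * c)) + 0) / (pX 0 1 + pX 1 0) =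
        2 * (1 - p_s) * pX 1 0 * pX 0 1 / ((pX 0 1 + pX 1 0) * (1 + (1 - p_s) * (pX 1 0 - pX 0 0)))"
      unfolding denominator by (simp add: q_def ac_simps)
    ultimately show ?thesis by (simp only:)
  qed
  moreover have "convergent w" if "\<not> (pX 0 1 = 1 \<and> pX 1 0 = 1)"
    using limits(2)[OF that] by (rule convergentI)
  moreover have "m \<longlonglongrightarrow> 1 / p_s * (1 - p_s * Q)" if w: "w \<longlonglongrightarrow> Q" for Q
  proof -
    \<comment> \<open>Solving the recursion of \<open>w\<close> for \<open>x\<close> shows that
      convergence of the estimate probability forces the source probability to the same limit. This
      covers the periodic source as well.\<close>
    have "(\<lambda>n. (w (Suc n) - q * w n) / p_s) \<longlonglongrightarrow> (Q - q * Q) / p_s"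
      using \<open>0 < p_s\<close> by (intro tendsto_intros LIMSEQ_Suc w) simp
    moreover have "\<forall>\<^sub>F n in sequentially. (w (Suc n) - q * w n) / p_s = x (Suc n)"
      using w_Suc \<open>0 < p_s\<close> by (intro eventually_sequentiallyI[of 1]) simp
    ultimately have "(\<lambda>n. x (Suc n)) \<longlonglongrightarrow> (Q - q * Q) / p_s"
      by (rule Lim_transform_eventually)
    moreover have "(Q - q * Q) / p_s = Q" using \<open>0 < p_s\<close> by (simp add: q_def field_simps)
    ultimately have "x \<longlonglongrightarrow> Q" by (simp add: filterlim_sequentially_Suc)
    then have "(\<lambda>n. q + p_s * (1 - x n)) \<longlonglongrightarrow> q + p_s * (1 - Q)" by (intro tendsto_intros)
    then have "m \<longlonglongrightarrow> (q + p_s * (1 - Q)) / (1 - q)"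
      using q m_Suc by (intro affine_recursion_tendsto[where N=2 and b="\<lambda>n. q + p_s * (1 - x n)"]) auto
    moreover have "(q + p_s * (1 - Q)) / (1 - q) = 1 / p_s * (1 - p_s * Q)"
      using \<open>0 < p_s\<close> by (simp add: q_def field_simps)
    ultimately show ?thesis by simp
  qed
  ultimately show ?thesis
    using received unfolding d_def[abs_def] w_def[abs_def] m_def[abs_def] by blast
qed

end
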